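(* Let $\lambda\in\mathbb C^*$ and $\epsilon\in\{0,1\}$, and let $V$ be an irreducible quasi-finite highest weight module over the Lie algebra $\mathcal D$ of differential operators on $\mathbb C[t,t^{-1}]$. Then the tensor product $\Omega(\lambda,\epsilon)\otimes V$ is an irreducible $\mathcal D$-module.
   Context: All algebras and modules are over $\mathbb C$; $\mathbb N$ denotes the non-negative integers and $\mathbb C^*=\mathbb C\setminus\{0\}$. $\mathcal D_{ass}$ is the associative algebra of all differential operators on $\mathbb C[t,t^{-1}]$. With $D=t\frac{d}{dt}$ it has basis $\{t^mD^n\mid m\in\mathbb Z,n\in\mathbb N\}$ and multiplication $$(t^{m_1}D^{n_1})(t^{m_2}D^{n_2})=\sum_{i=0}^{n_1}\binom{n_1}{i}m_2^i\,t^{m_1+m_2}D^{n_1+n_2-i}$$ (with $0^0=1$). $\mathcal D$ is the Lie algebra with the same underlying space and the commutator bracket. It is $\mathbb Z$-graded by $\mathcal D_i=\mathrm{span}_{\mathbb C}\{t^iD^n\mid n\ge 0\}$; put $\mathcal D_+=\sum_{i>0}\mathcal D_i$. For $\lambda\in\mathbb C^*$ and $\epsilon\in\{0,1\}$, $\Omega(\lambda,\epsilon)$ is the $\mathcal D$-module with underlying space $\mathbb C[x]$ and action $$t^mD^n\cdot f(x)=\beta^{1-n}\lambda^m(x-\epsilon m)^nf(x-m),\qquad \beta=(-1)^{1-\epsilon},$$ for $f(x)\in\mathbb C[x]$, $m\in\mathbb Z$, $n\in\mathbb N$. An irreducible $\mathcal D$-module $V$ is a highest weight module if there is a nonzero $v\in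 V$ such that $\mathbb Cv$ is a one-dimensional $\mathcal D_0$-module and $\mathcal D_+v=0$. Such a $V$ is graded, $V=\bigoplus_{j\ge0}V_{-j}$, where $V_{-j}$ is spanned by the vectors $(t^{m_1}D^{n_1})\cdots(t^{m_k}D^{n_k})v$ with $m_1+\cdots+m_k=-j$; $V$ is quasi-finite if every $V_{-j}$ is finite-dimensional. The tensor product carries the usual action $a(u\otimes w)=au\otimes w+u\otimes aw$ for $a\in\mathcal D$. *)

theory Defs
  imports Complex_Main "HOL-Library.Poly_Mapping" "HOL-Computational_Algebra.Polynomial"
begin

section \<open>Complex vector spaces\<close>

class complex_vector = ab_group_add +
  fixes scaleC :: "complex \<Rightarrow> 'a \<Rightarrow> 'a"  (infixr \<open>*\<^sub>C\<close> 75)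
  assumes scaleC_add_right: "a *\<^sub>C (x + y) = a *\<^sub>C x + a *\<^sub>C y"
    and scaleC_add_left: "(a + b) *\<^sub>C x = a *\<^sub>C x + b *\<^sub>C x"
    and scaleC_scaleC: "a *\<^sub>C b *\<^sub>C x = (a * b) *\<^sub>C x"
    and scaleC_one: "1 *\<^sub>C x = x"

global_interpretation complex_vector:
  vector_space "scaleC :: complex \<Rightarrow> 'a \<Rightarrow> 'a::complex_vector"
  by unfold_locales
    (simp_all add: scaleC_add_right scaleC_add_left scaleC_scaleC scaleC_one)

abbreviation csubspace :: "'a::complex_vector set \<Rightarrow> bool" where
  "csubspace \<equiv> module.subspace scaleC"

abbreviation cspan :: "'a::complex_vector set \<Rightarrow> 'a set" where
  "cspan \<equiv> module.span scaleC"

abbreviation clinear :: "('a::complex_vector \<Rightarrow> 'b::complex_vector) \<Rightarrow> bool" where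
  "clinear \<equiv> Vector_Spaces.linear scaleC scaleC"

lemma clinear_iff:
  "clinear f \<longleftrightarrow> (\<forall>x y. f (x + y) = f x + f y) \<and> (\<forall>c x. f (c *\<^sub>C x) = c *\<^sub>C f x)"
  by (simp add: Vector_Spaces.linear_iff complex_vector.vector_space_axioms)

definition cbilinear ::
  "('a::complex_vector \<Rightarrow> 'b::complex_vector \<Rightarrow> 'c::complex_vector) \<Rightarrow> bool" where
  "cbilinear B \<longleftrightarrow> (\<forall>x. clinear (B x)) \<and> (\<forall>y. clinear (\<lambda>x. B x y))"

definition finite_dimensional :: "'a::complex_vector set \<Rightarrow> bool" where
  "finite_dimensional S \<longleftrightarrow> csubspace S \<and> (\<exists>B. finite B \<and> S = cspan B)"

instantiation complex :: complex_vector
begin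
definition scaleC_complex :: "complex \<Rightarrow> complex \<Rightarrow> complex" where
  [simp]: "scaleC_complex c z = c * z"
instance by standard (simp_all add: algebra_simps)
end

instantiation poly :: (complex_vector) complex_vector
begin
definition scaleC_poly :: "complex \<Rightarrow> 'a poly \<Rightarrow> 'a poly" where
  "scaleC_poly c p = map_poly (scaleC c) p"
instance
  by standard (simp_all add: scaleC_poly_def poly_eq_iff coeff_map_poly
      scaleC_add_right scaleC_add_left scaleC_scaleC scaleC_one)
end

lemma scaleC_complex_poly: "c *\<^sub>C p = smult c p" for p :: "complex poly"
  by (simp add: scaleC_poly_def poly_eq_iff coeff_map_poly)

instantiation poly_mapping :: (type, complex_vector) complex_vector
begin
definition scaleC_poly_mapping :: "complex \<Rightarrow> ('a \<Rightarrow>\<^sub>0 'b) \<Rightarrow> 'a \<Rightarrow>\<^sub>0 'b" where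
  "scaleC_poly_mapping c f = Poly_Mapping.map (scaleC c) f"

lemma lookup_scaleC:
  "Poly_Mapping.lookup (c *\<^sub>C f) k = c *\<^sub>C Poly_Mapping.lookup f k" for f :: "'a \<Rightarrow>\<^sub>0 'b"
  by (simp add: scaleC_poly_mapping_def Poly_Mapping.map.rep_eq when_def)

instance
  by standard (simp_all add: poly_mapping_eq_iff fun_eq_iff lookup_scaleC lookup_add
      scaleC_add_right scaleC_add_left scaleC_scaleC scaleC_one)
end

definition linear_extension :: "('k \<Rightarrow> 'v) \<Rightarrow> ('k \<Rightarrow>\<^sub>0 complex) \<Rightarrow> 'v::complex_vector" where
  "linear_extension g f = (\<Sum>k\<in>Poly_Mapping.keys f. Poly_Mapping.lookup f k *\<^sub>C g k)"

lemma linear_extension_superset: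
  assumes "finite S" "Poly_Mapping.keys f \<subseteq> S"
  shows "linear_extension g f = (\<Sum>k\<in>S. Poly_Mapping.lookup f k *\<^sub>C g k)"
  unfolding linear_extension_def
  by (rule sum.mono_neutral_left) (use assms in \<open>auto simp: in_keys_iff\<close>)

lemma clinear_linear_extension: "clinear (linear_extension g)"
  unfolding clinear_iff
proof (intro conjI allI)
  fix x y :: "'a \<Rightarrow>\<^sub>0 complex"
  let ?S = "Poly_Mapping.keys x \<union> Poly_Mapping.keys y"
  show "linear_extension g (x + y) = linear_extension g x + linear_extension g y"
    by (subst (1 2 3) linear_extension_superset[of ?S])
      (use Poly_Mapping.keys_add[of x y] in \<open>auto simp: lookup_add scaleC_add_left sum.distrib\<close>)
next
  fix c and x :: "'a \<Rightarrow>\<^sub>0 complex"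
  show "linear_extension g (c *\<^sub>C x) = c *\<^sub>C linear_extension g x"
    by (subst (1 2) linear_extension_superset[of "Poly_Mapping.keys x"])
      (auto simp: in_keys_iff lookup_scaleC complex_vector.scale_sum_right)
qed

lemma linear_extension_single [simp]: "linear_extension g (Poly_Mapping.single k c) = c *\<^sub>C g k"
  by (cases "c = 0") (simp_all add: linear_extension_def)

lemma poly_mapping_expansion:
  "(\<Sum>k\<in>Poly_Mapping.keys f. Poly_Mapping.lookup f k *\<^sub>C Poly_Mapping.single k 1) = f"
  for f :: "'k \<Rightarrow>\<^sub>0 complex"
proof (rule poly_mapping_eqI)
  fix j
  have "Poly_Mapping.lookup (\<Sum>k\<in>Poly_Mapping.keys f.
      Poly_Mapping.lookup f k *\<^sub>C Poly_Mapping.single k 1) j =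
    (\<Sum>k\<in>Poly_Mapping.keys f. if k = j then Poly_Mapping.lookup f j else 0)"
    unfolding lookup_sum by (rule sum.cong) (auto simp: lookup_scaleC lookup_single)
  then show "Poly_Mapping.lookup (\<Sum>k\<in>Poly_Mapping.keys f.
      Poly_Mapping.lookup f k *\<^sub>C Poly_Mapping.single k 1) j = Poly_Mapping.lookup f j"
    by (simp add: in_keys_iff)
qed


lemma clinear_linear_extension_param:
  assumes "\<And>k. clinear (\<lambda>x. g x k)"
  shows "clinear (\<lambda>x. linear_extension (g x) f)"
  using assms
  by (simp add: clinear_iff linear_extension_def sum.distrib scaleC_add_right
      complex_vector.scale_sum_right mult.commute)

lemma clinear_eqI:
  fixes F G :: "('k \<Rightarrow>\<^sub>0 complex) \<Rightarrow> 'v::complex_vector"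
  assumes "clinear F" "clinear G"
    and eq: "\<And>k. F (Poly_Mapping.single k 1) = G (Poly_Mapping.single k 1)"
  shows "F a = G a"
proof -
  interpret F: Vector_Spaces.linear scaleC scaleC F by fact
  interpret G: Vector_Spaces.linear scaleC scaleC G by fact
  have "F (\<Sum>k\<in>Poly_Mapping.keys a. Poly_Mapping.lookup a k *\<^sub>C Poly_Mapping.single k 1) =
    G (\<Sum>k\<in>Poly_Mapping.keys a. Poly_Mapping.lookup a k *\<^sub>C Poly_Mapping.single k 1)"
    by (simp only: F.sum G.sum F.scale G.scale eq)
  then show ?thesis by (simp only: poly_mapping_expansion)
qed

lemma clinear_uminus: "clinear f \<Longrightarrow> clinear (\<lambda>x. - f x)"
  by (simp add: clinear_iff)

lemma clinear_compose: "clinear f \<Longrightarrow> clinear g \<Longrightarrow> clinear (\<lambda>x. f (g x))"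
  by (simp add: clinear_iff)


section \<open>Tensor products\<close>

definition tensor_relations ::
  "('u::complex_vector \<times> 'v::complex_vector \<Rightarrow>\<^sub>0 complex) set" where
  "tensor_relations =
     (let e = (\<lambda>u w. Poly_Mapping.single (u, w) 1) in
       {e (u + u') w - e u w - e u' w | u u' w. True} \<union>
       {e u (w + w') - e u w - e u w' | u w w'. True} \<union>
       {e (c *\<^sub>C u) w - c *\<^sub>C e u w | c u w. True} \<union>
       {e u (c *\<^sub>C w) - c *\<^sub>C e u w | c u w. True})"

quotient_type (overloaded) ('u, 'v) tensor =
    "'u::complex_vector \<times> 'v::complex_vector \<Rightarrow>\<^sub>0 complex" /
    "\<lambda>f g. f - g \<in> cspan tensor_relations"
proof (rule equivpI)
  show "reflp (\<lambda>f g. f - g \<in> cspan (tensor_relations :: ('u \<times> 'v \<Rightarrow>\<^sub>0 complex) set))"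
    by (rule reflpI) (simp add: complex_vector.span_zero)
  show "symp (\<lambda>f g. f - g \<in> cspan (tensor_relations :: ('u \<times> 'v \<Rightarrow>\<^sub>0 complex) set))"
    using complex_vector.span_neg by (fastforce intro: sympI)
  show "transp (\<lambda>f g. f - g \<in> cspan (tensor_relations :: ('u \<times> 'v \<Rightarrow>\<^sub>0 complex) set))"
    using complex_vector.span_add by (fastforce intro: transpI)
qed

instantiation tensor :: (complex_vector, complex_vector) complex_vector
begin

lift_definition zero_tensor :: "('a, 'b) tensor" is "0" .

lift_definition plus_tensor :: "('a, 'b) tensor \<Rightarrow> ('a, 'b) tensor \<Rightarrow> ('a, 'b) tensor" is "(+)"
  unfolding add_diff_add by (rule complex_vector.span_add)

lift_definition uminus_tensor :: "('a, 'b) tensor \<Rightarrow> ('a, 'b) tensor" is "uminus"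
  unfolding minus_diff_minus by (rule complex_vector.span_neg)

lift_definition minus_tensor :: "('a, 'b) tensor \<Rightarrow> ('a, 'b) tensor \<Rightarrow> ('a, 'b) tensor" is "(-)"
proof -
  fix a b c d :: "'a \<times> 'b \<Rightarrow>\<^sub>0 complex"
  assume "a - b \<in> cspan tensor_relations" "c - d \<in> cspan tensor_relations"
  then have "(a - b) - (c - d) \<in> cspan tensor_relations"
    by (rule complex_vector.span_diff)
  then show "(a - c) - (b - d) \<in> cspan tensor_relations"
    by (simp add: algebra_simps)
qed

lift_definition scaleC_tensor :: "complex \<Rightarrow> ('a, 'b) tensor \<Rightarrow> ('a, 'b) tensor" is "scaleC"
  unfolding complex_vector.scale_right_diff_distrib[symmetric] by (rule complex_vector.span_scale)

instance
proof -
  have eq: "f - g \<in> cspan tensor_relations" if "f = g" for f g :: "'a \<times> 'b \<Rightarrow>\<^sub>0 complex"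
    using that by (simp add: complex_vector.span_zero)
  show "OFCLASS(('a, 'b) tensor, complex_vector_class)"
    by (standard; transfer; rule eq)
      (rule add.assoc add.commute add.left_neutral left_minus diff_conv_add_uminus
        scaleC_add_right scaleC_add_left scaleC_scaleC scaleC_one)+
qed

end

lift_definition pure_tensor ::
  "'u::complex_vector \<Rightarrow> 'v::complex_vector \<Rightarrow> ('u, 'v) tensor"  (infixl \<open>\<otimes>\<^sub>C\<close> 73)
  is "\<lambda>u w. Poly_Mapping.single (u, w) 1" .

lemma
  fixes u u' :: "'u::complex_vector" and w w' :: "'v::complex_vector"
  shows pure_tensor_add_left: "(u + u') \<otimes>\<^sub>C w = u \<otimes>\<^sub>C w + u' \<otimes>\<^sub>C w"
    and pure_tensor_add_right: "u \<otimes>\<^sub>C (w + w') = u \<otimes>\<^sub>C w + u \<otimes>\<^sub>C w'"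
    and pure_tensor_scale_left: "(c *\<^sub>C u) \<otimes>\<^sub>C w = c *\<^sub>C (u \<otimes>\<^sub>C w)"
    and pure_tensor_scale_right: "u \<otimes>\<^sub>C (c *\<^sub>C w) = c *\<^sub>C (u \<otimes>\<^sub>C w)"
  by (transfer, rule complex_vector.span_base,
      unfold tensor_relations_def Let_def diff_diff_eq, blast)+

lemma cbilinear_pure_tensor: "cbilinear (\<otimes>\<^sub>C)"
  by (simp add: cbilinear_def clinear_iff pure_tensor_add_left pure_tensor_add_right
      pure_tensor_scale_left pure_tensor_scale_right)

lemma span_pure_tensor: "cspan (range (\<lambda>(u, w). u \<otimes>\<^sub>C w)) = UNIV"
proof -
  have "t \<in> cspan (range (\<lambda>(u, w). u \<otimes>\<^sub>C w))" for t :: "('a, 'b) tensor"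
  proof -
    let ?f = "rep_tensor t"
    have sum: "abs_tensor (\<Sum>k\<in>K. g k) = (\<Sum>k\<in>K. abs_tensor (g k))"
      if "finite K" for K and g :: "'a \<times> 'b \<Rightarrow> ('a \<times> 'b \<Rightarrow>\<^sub>0 complex)"
      using that by (induction K rule: finite_induct)
        (simp_all add: zero_tensor.abs_eq plus_tensor.abs_eq[symmetric])
    have "t = abs_tensor ?f"
      by (simp add: Quotient3_abs_rep[OF Quotient3_tensor])
    also have "\<dots> = abs_tensor (\<Sum>k\<in>Poly_Mapping.keys ?f. Poly_Mapping.lookup ?f k *\<^sub>C Poly_Mapping.single k 1)"
      by (simp only: poly_mapping_expansion)
    also have "\<dots> = (\<Sum>k\<in>Poly_Mapping.keys ?f. Poly_Mapping.lookup ?f k *\<^sub>C (fst k \<otimes>\<^sub>C snd k))"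
      by (simp add: sum scaleC_tensor.abs_eq[symmetric] pure_tensor.abs_eq)
    also have "\<dots> \<in> cspan (range (\<lambda>(u, w). u \<otimes>\<^sub>C w))"
      by (intro complex_vector.span_sum complex_vector.span_scale complex_vector.span_base)
        (auto simp: image_iff)
    finally show ?thesis .
  qed
  then show ?thesis by blast
qed

text \<open>
  For a bilinear map \<open>B\<close> the value of \<open>tensor_lift B\<close> does not depend on the representative
  chosen by \<open>rep_tensor\<close>, and \<open>tensor_lift B\<close> is the linear map induced by \<open>B\<close>.
\<close>

definition tensor_lift ::
  "('u \<Rightarrow> 'v \<Rightarrow> 'w) \<Rightarrow> ('u::complex_vector, 'v::complex_vector) tensor \<Rightarrow> 'w::complex_vector" where
  "tensor_lift B t = linear_extension (\<lambda>(u, w). B u w) (rep_tensor t)"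

lemma tensor_lift_abs:
  assumes "cbilinear B"
  shows "tensor_lift B (abs_tensor f) = linear_extension (\<lambda>(u, w). B u w) f"
proof -
  let ?L = "linear_extension (\<lambda>(u, w). B u w)"
  interpret L: Vector_Spaces.linear scaleC scaleC ?L
    by (rule clinear_linear_extension)
  have "?L r = 0" if "r \<in> tensor_relations" for r
    using that assms unfolding tensor_relations_def Let_def cbilinear_def clinear_iff
    by (auto simp: L.diff L.scale scaleC_one)
  then have "?L r = 0" if "r \<in> cspan tensor_relations" for r
    using that L.eq_0_on_span by blast
  moreover have "rep_tensor (abs_tensor f) - f \<in> cspan tensor_relations"
    by (rule Quotient3_rep_abs[OF Quotient3_tensor]) (simp add: complex_vector.span_zero)
  ultimately have "?L (rep_tensor (abs_tensor f) - f) = 0" by blast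
  then show ?thesis by (simp add: tensor_lift_def L.diff)
qed

lemma tensor_lift_pure: "cbilinear B \<Longrightarrow> tensor_lift B (u \<otimes>\<^sub>C w) = B u w"
  by (simp add: pure_tensor.abs_eq tensor_lift_abs scaleC_one)

lemma clinear_tensor_lift:
  assumes "cbilinear B"
  shows "clinear (tensor_lift B)"
proof -
  interpret L: Vector_Spaces.linear scaleC scaleC "linear_extension (\<lambda>(u, w). B u w)"
    by (rule clinear_linear_extension)
  show ?thesis unfolding clinear_iff
  proof (intro conjI allI)
    fix x y show "tensor_lift B (x + y) = tensor_lift B x + tensor_lift B y"
      by (induction x; induction y) (simp add: plus_tensor.abs_eq tensor_lift_abs[OF assms] L.add)
  next
    fix c x show "tensor_lift B (c *\<^sub>C x) = c *\<^sub>C tensor_lift B x"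
      by (induction x) (simp add: scaleC_tensor.abs_eq tensor_lift_abs[OF assms] L.scale)
  qed
qed


section \<open>The algebra of differential operators\<close>

text \<open>
  An operator is given by its coordinates in the basis \<open>t\<^sup>m D\<^sup>n\<close>, indexed by \<open>(m, n)\<close>.
  The product of the algebra is \<open>dmult\<close>, not the convolution product of \<^theory>\<open>HOL-Library.Poly_Mapping\<close>.
\<close>

type_synonym diffop = "int \<times> nat \<Rightarrow>\<^sub>0 complex"

definition tD :: "int \<Rightarrow> nat \<Rightarrow> diffop" where
  "tD m n = Poly_Mapping.single (m, n) 1"

definition basis_mult :: "int \<times> nat \<Rightarrow> int \<times> nat \<Rightarrow> diffop" where
  "basis_mult = (\<lambda>(m1, n1) (m2, n2).
     \<Sum>i\<le>n1. (of_nat (n1 choose i) * of_int m2 ^ i) *\<^sub>C tD (m1 + m2) (n1 + n2 - i))"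

definition dmult :: "diffop \<Rightarrow> diffop \<Rightarrow> diffop" where
  "dmult a b = linear_extension (\<lambda>p. linear_extension (basis_mult p) b) a"

definition dbracket :: "diffop \<Rightarrow> diffop \<Rightarrow> diffop" where
  "dbracket a b = dmult a b - dmult b a"

definition graded_part :: "int \<Rightarrow> diffop set" where
  "graded_part i = cspan {tD i n | n. True}"

definition D_plus :: "diffop set" where
  "D_plus = cspan (\<Union>i\<in>{0<..}. graded_part i)"


section \<open>Modules over the Lie algebra of differential operators\<close>

definition diffop_module :: "(diffop \<Rightarrow> 'v \<Rightarrow> 'v::complex_vector) \<Rightarrow> bool" where
  "diffop_module act \<longleftrightarrow> cbilinear act \<and>
     (\<forall>a b v. act (dbracket a b) v = act a (act b v) - act b (act a v))"

definition submodule :: "(diffop \<Rightarrow> 'v \<Rightarrow> 'v::complex_vector) \<Rightarrow> 'v set \<Rightarrow> bool" where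
  "submodule act W \<longleftrightarrow> csubspace W \<and> (\<forall>a. \<forall>w\<in>W. act a w \<in> W)"

definition irreducible_module :: "(diffop \<Rightarrow> 'v \<Rightarrow> 'v::complex_vector) \<Rightarrow> bool" where
  "irreducible_module act \<longleftrightarrow> diffop_module act \<and> (UNIV :: 'v set) \<noteq> {0} \<and>
     (\<forall>W. submodule act W \<longrightarrow> W = {0} \<or> W = UNIV)"

definition highest_weight_vector :: "(diffop \<Rightarrow> 'v \<Rightarrow> 'v) \<Rightarrow> 'v::complex_vector \<Rightarrow> bool" where
  "highest_weight_vector act v \<longleftrightarrow> v \<noteq> 0 \<and>
     (\<forall>a\<in>graded_part 0. act a v \<in> cspan {v}) \<and> (\<forall>a\<in>D_plus. act a v = 0)"

definition highest_weight_module :: "(diffop \<Rightarrow> 'v \<Rightarrow> 'v::complex_vector) \<Rightarrow> bool" where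
  "highest_weight_module act \<longleftrightarrow> irreducible_module act \<and> (\<exists>v. highest_weight_vector act v)"

text \<open>The list \<open>ps\<close> is \<open>(m\<^sub>1, n\<^sub>1), \<dots>, (m\<^sub>k, n\<^sub>k)\<close>; \<open>k = 0\<close> is allowed and yields \<open>v\<close> itself.\<close>

definition weight_component ::
  "(diffop \<Rightarrow> 'v \<Rightarrow> 'v) \<Rightarrow> 'v \<Rightarrow> nat \<Rightarrow> 'v::complex_vector set" where
  "weight_component act v j =
     cspan {foldr (\<lambda>(m, n) w. act (tD m n) w) ps v | ps. sum_list (map fst ps) = - int j}"

text \<open>
  The highest weight vector of an irreducible highest weight module is unique up to a scalar,
  so that its choice does not matter here.
\<close>

definition quasi_finite :: "(diffop \<Rightarrow> 'v \<Rightarrow> 'v::complex_vector) \<Rightarrow> bool" where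
  "quasi_finite act \<longleftrightarrow> (\<exists>v. highest_weight_vector act v \<and>
     (\<forall>j. finite_dimensional (weight_component act v j)))"

definition Omega :: "complex \<Rightarrow> nat \<Rightarrow> diffop \<Rightarrow> complex poly \<Rightarrow> complex poly" where
  "Omega lam eps a f = linear_extension (\<lambda>(m, n).
     let \<beta> = (- 1) ^ (1 - eps) in
     smult (\<beta> powi (1 - int n) * lam powi m)
       ([:- (of_nat eps * of_int m), 1:] ^ n * pcompose f [:- of_int m, 1:])) a"

definition tensor_action ::
  "(diffop \<Rightarrow> 'u \<Rightarrow> 'u) \<Rightarrow> (diffop \<Rightarrow> 'v \<Rightarrow> 'v) \<Rightarrow>
   diffop \<Rightarrow> ('u::complex_vector, 'v::complex_vector) tensor \<Rightarrow> ('u, 'v) tensor" where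
  "tensor_action \<rho> \<sigma> a = tensor_lift (\<lambda>u w. \<rho> a u \<otimes>\<^sub>C w + u \<otimes>\<^sub>C \<sigma> a w)"

lemma Omega_tD:
  fixes m :: int
  shows Omega_1_tD: "Omega lam 1 (tD m n) f =
      smult (lam powi m) ([:- of_int m, 1:] ^ n * pcompose f [:- of_int m, 1:])"
    and Omega_0_tD: "Omega lam 0 (tD m n) f =
      - smult (lam powi m) ([:0, - 1:] ^ n * pcompose f [:- of_int m, 1:])"
proof -
  show "Omega lam 1 (tD m n) f =
      smult (lam powi m) ([:- of_int m, 1:] ^ n * pcompose f [:- of_int m, 1:])"
    by (simp add: Omega_def tD_def scaleC_one Let_def)
  have "[:0, - 1:] ^ n = smult ((- 1) ^ n) ([:0, 1 :: complex:] ^ n)"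
    by (simp flip: smult_power)
  moreover have "(- 1 :: complex) powi (1 - int n) = - ((- 1) ^ n)"
    by (simp add: power_int_diff) (simp add: field_simps flip: power_mult_distrib)
  ultimately show "Omega lam 0 (tD m n) f =
      - smult (lam powi m) ([:0, - 1:] ^ n * pcompose f [:- of_int m, 1:])"
    by (simp add: Omega_def tD_def scaleC_one Let_def mult.commute)
qed

lemma clinear_Omega_left: "clinear (\<lambda>a. Omega lam eps a f)"
  unfolding Omega_def by (rule clinear_linear_extension)

lemma clinear_Omega_right: "clinear (Omega lam eps a)"
  unfolding Omega_def
  by (rule clinear_linear_extension_param)
    (auto simp: clinear_iff Let_def scaleC_complex_poly pcompose_add pcompose_smult
      algebra_simps smult_add_right)

lemma cbilinear_dmult: "cbilinear dmult"
  unfolding cbilinear_def dmult_def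
  by (intro conjI allI clinear_linear_extension_param clinear_linear_extension)

lemma shift_power:
  fixes x y :: "complex poly"
  shows "(\<Sum>i\<le>n1. smult (of_nat (n1 choose i) * c ^ i) (y ^ (n1 + n2 - i))) =
    (y + [:c:]) ^ n1 * y ^ n2"
proof -
  have "(y + [:c:]) ^ n1 = (\<Sum>i\<le>n1. of_nat (n1 choose i) * [:c:] ^ i * y ^ (n1 - i))"
    by (subst add.commute) (rule binomial_ring)
  also have "\<dots> = (\<Sum>i\<le>n1. smult (of_nat (n1 choose i) * c ^ i) (y ^ (n1 - i)))"
    by (intro sum.cong refl) (simp add: of_nat_poly poly_const_pow mult.commute)
  finally show ?thesis
    by (auto simp: sum_distrib_right power_add[symmetric] intro!: sum.cong)
qed

lemma cbilinear_eqI: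
  fixes F G :: "('k \<Rightarrow>\<^sub>0 complex) \<Rightarrow> ('l \<Rightarrow>\<^sub>0 complex) \<Rightarrow> 'v::complex_vector"
  assumes F: "\<And>a. clinear (F a)" "\<And>b. clinear (\<lambda>a. F a b)"
    and G: "\<And>a. clinear (G a)" "\<And>b. clinear (\<lambda>a. G a b)"
    and eq: "\<And>k l. F (Poly_Mapping.single k 1) (Poly_Mapping.single l 1) =
      G (Poly_Mapping.single k 1) (Poly_Mapping.single l 1)"
  shows "F a b = G a b"
  by (rule clinear_eqI[where F = "\<lambda>a. F a b"], rule F, rule G, rule clinear_eqI, rule F, rule G, rule eq)

lemma pcompose_power: "pcompose (p ^ n) q = pcompose p q ^ n"
  for p q :: "'a::comm_semiring_1 poly"
  by (induction n) (simp_all add: pcompose_mult pcompose_1)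

lemma Omega_basis_mult:
  assumes tD: "\<And>m n. Omega lam eps (tD m n) f =
    smult (s * lam powi m) (r m ^ n * pcompose f [:- of_int m, 1:])"
  shows "Omega lam eps (basis_mult (m1, n1) (m2, n2)) f =
    smult (s * lam powi (m1 + m2)) ((r (m1 + m2) + [:of_int m2:]) ^ n1 * r (m1 + m2) ^ n2 *
      pcompose f [:- of_int (m1 + m2), 1:])"
proof -
  interpret L: Vector_Spaces.linear scaleC scaleC "\<lambda>a. Omega lam eps a f"
    by (rule clinear_Omega_left)
  have "Omega lam eps (basis_mult (m1, n1) (m2, n2)) f =
    (\<Sum>i\<le>n1. smult (s * lam powi (m1 + m2))
      (smult (of_nat (n1 choose i) * of_int m2 ^ i) (r (m1 + m2) ^ (n1 + n2 - i)) *
        pcompose f [:- of_int (m1 + m2), 1:]))"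
    by (simp add: basis_mult_def L.sum L.scale tD scaleC_complex_poly mult_ac
        del: of_int_add power_int_add)
  also have "\<dots> = smult (s * lam powi (m1 + m2))
      ((\<Sum>i\<le>n1. smult (of_nat (n1 choose i) * of_int m2 ^ i) (r (m1 + m2) ^ (n1 + n2 - i))) *
        pcompose f [:- of_int (m1 + m2), 1:])"
    by (simp only: sum_distrib_right complex_vector.scale_sum_right flip: scaleC_complex_poly)
  finally show ?thesis by (simp only: shift_power)
qed

lemma dmult_tD: "dmult (tD m1 n1) (tD m2 n2) = basis_mult (m1, n1) (m2, n2)"
  by (simp add: dmult_def tD_def scaleC_one)

lemma Omega_1_dmult:
  assumes "lam \<noteq> 0"
  shows "Omega lam 1 (dmult a b) f = Omega lam 1 a (Omega lam 1 b f)"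
proof (rule cbilinear_eqI[where F = "\<lambda>a b. Omega lam 1 (dmult a b) f"])
  fix p q :: "int \<times> nat"
  obtain m1 n1 m2 n2 where pq: "p = (m1, n1)" "q = (m2, n2)" by (cases p, cases q)
  have 1: "[:- of_int (m1 + m2), 1:] + [:of_int m2:] = [:- of_int m1, 1 :: complex:]"
    by simp
  have 2: "pcompose [:- of_int m2, 1:] [:- of_int m1, 1:] =
      [:- of_int (m1 + m2), 1 :: complex:]"
    by (simp add: pcompose_pCons)
  have "Omega lam 1 (dmult (tD m1 n1) (tD m2 n2)) f =
    smult (1 * lam powi (m1 + m2)) ([:- of_int m1, 1:] ^ n1 * [:- of_int (m1 + m2), 1:] ^ n2 *
      pcompose f [:- of_int (m1 + m2), 1:])"
    unfolding dmult_tD 1[symmetric] by (rule Omega_basis_mult) (simp only: Omega_1_tD mult_1)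
  also have "\<dots> = Omega lam 1 (tD m1 n1) (Omega lam 1 (tD m2 n2) f)"
    unfolding Omega_1_tD pcompose_smult pcompose_mult pcompose_power pcompose_assoc[symmetric] 2
    using assms by (simp add: power_int_add mult_ac del: of_int_add)
  finally show "Omega lam 1 (dmult (Poly_Mapping.single p 1) (Poly_Mapping.single q 1)) f =
    Omega lam 1 (Poly_Mapping.single p 1) (Omega lam 1 (Poly_Mapping.single q 1) f)"
    by (simp only: pq tD_def)
qed (use cbilinear_dmult in \<open>auto simp: cbilinear_def
    intro: clinear_compose[OF clinear_Omega_left] clinear_compose[OF clinear_Omega_right]
      clinear_Omega_left\<close>)

lemma Omega_0_dmult:
  assumes "lam \<noteq> 0"
  shows "Omega lam 0 (dmult a b) f = - Omega lam 0 b (Omega lam 0 a f)"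
proof (rule cbilinear_eqI[where F = "\<lambda>a b. Omega lam 0 (dmult a b) f"])
  fix p q :: "int \<times> nat"
  obtain m1 n1 m2 n2 where pq: "p = (m1, n1)" "q = (m2, n2)" by (cases p, cases q)
  have 1: "[:0, - 1:] + [:of_int m2:] = [:of_int m2, - 1 :: complex:]"
    by simp
  have 2: "pcompose [:- of_int m1, 1:] [:- of_int m2, 1:] =
      [:- of_int (m1 + m2), 1 :: complex:]"
    and 3: "pcompose [:0, - 1:] [:- of_int m2, 1:] = [:of_int m2, - 1 :: complex:]"
    by (simp_all add: pcompose_pCons)
  have "Omega lam 0 (dmult (tD m1 n1) (tD m2 n2)) f =
    smult (- 1 * lam powi (m1 + m2)) ([:of_int m2, - 1:] ^ n1 * [:0, - 1:] ^ n2 *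
      pcompose f [:- of_int (m1 + m2), 1:])"
    unfolding dmult_tD 1[symmetric] by (rule Omega_basis_mult) (simp add: Omega_0_tD)
  also have "\<dots> = - Omega lam 0 (tD m2 n2) (Omega lam 0 (tD m1 n1) f)"
    unfolding Omega_0_tD pcompose_uminus pcompose_smult pcompose_mult pcompose_power
      pcompose_assoc[symmetric] 2 3
    using assms by (simp add: power_int_add mult_ac del: of_int_add)
  finally show "Omega lam 0 (dmult (Poly_Mapping.single p 1) (Poly_Mapping.single q 1)) f =
    - Omega lam 0 (Poly_Mapping.single q 1) (Omega lam 0 (Poly_Mapping.single p 1) f)"
    by (simp only: pq tD_def)
qed (use cbilinear_dmult in \<open>auto simp: cbilinear_def
    intro: clinear_compose[OF clinear_Omega_left] clinear_compose[OF clinear_Omega_right]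
      clinear_Omega_left
      clinear_uminus[OF clinear_compose[OF clinear_Omega_right clinear_Omega_left]]
      clinear_uminus[OF clinear_Omega_left]\<close>)

lemma diffop_module_Omega:
  assumes "lam \<noteq> 0" "eps \<in> {0, 1}"
  shows "diffop_module (Omega lam eps)"
proof -
  have "Omega lam eps (dbracket a b) f =
    Omega lam eps a (Omega lam eps b f) - Omega lam eps b (Omega lam eps a f)" for a b f
  proof -
    interpret L: Vector_Spaces.linear scaleC scaleC "\<lambda>a. Omega lam eps a f"
      by (rule clinear_Omega_left)
    show ?thesis
      using assms Omega_0_dmult[of lam a b f] Omega_0_dmult[of lam b a f]
        Omega_1_dmult[of lam a b f] Omega_1_dmult[of lam b a f]
      by (auto simp: dbracket_def L.diff)
  qed
  then show ?thesis
    by (simp add: diffop_module_def cbilinear_def clinear_Omega_left clinear_Omega_right)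
qed

lemma cbilinear_tensor_action_aux:
  assumes "diffop_module \<rho>" "diffop_module \<sigma>"
  shows "cbilinear (\<lambda>u w. \<rho> a u \<otimes>\<^sub>C w + u \<otimes>\<^sub>C \<sigma> a w)"
  using assms unfolding diffop_module_def cbilinear_def clinear_iff
  by (simp add: scaleC_add_right pure_tensor_add_left pure_tensor_add_right
      pure_tensor_scale_left pure_tensor_scale_right add_ac)

lemma tensor_action_pure:
  assumes "diffop_module \<rho>" "diffop_module \<sigma>"
  shows "tensor_action \<rho> \<sigma> a (u \<otimes>\<^sub>C w) = \<rho> a u \<otimes>\<^sub>C w + u \<otimes>\<^sub>C \<sigma> a w"
  unfolding tensor_action_def
  by (rule tensor_lift_pure) (rule cbilinear_tensor_action_aux[OF assms])

lemma clinear_tensor_action: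
  assumes "diffop_module \<rho>" "diffop_module \<sigma>"
  shows "clinear (tensor_action \<rho> \<sigma> a)"
  unfolding tensor_action_def
  by (rule clinear_tensor_lift) (rule cbilinear_tensor_action_aux[OF assms])

lemma clinear_tensor_eqI:
  assumes "clinear F" "clinear G" "\<And>u w. F (u \<otimes>\<^sub>C w) = G (u \<otimes>\<^sub>C w)"
  shows "F t = G t"
proof -
  interpret vector_space_pair
    "scaleC :: complex \<Rightarrow> ('a, 'b) tensor \<Rightarrow> _" "scaleC :: complex \<Rightarrow> 'c \<Rightarrow> 'c"
    by unfold_locales
  show ?thesis
    by (rule linear_eq_on[OF assms(1,2), of _ "range (\<lambda>(u, w). u \<otimes>\<^sub>C w)"])
      (use assms(3) in \<open>auto simp: span_pure_tensor\<close>)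
qed

lemma diffop_module_tensor_action:
  assumes "diffop_module \<rho>" "diffop_module \<sigma>"
  shows "diffop_module (tensor_action \<rho> \<sigma>)"
proof -
  let ?T = "tensor_action \<rho> \<sigma>"
  note T = tensor_action_pure[OF assms] and lin = clinear_tensor_action[OF assms]
  note T_lin = lin[unfolded clinear_iff]
  have mod: "\<rho> (a + b) u = \<rho> a u + \<rho> b u" "\<sigma> (a + b) w = \<sigma> a w + \<sigma> b w"
      "\<rho> (c *\<^sub>C a) u = c *\<^sub>C \<rho> a u" "\<sigma> (c *\<^sub>C a) w = c *\<^sub>C \<sigma> a w"
      "\<rho> (dbracket a b) u = \<rho> a (\<rho> b u) - \<rho> b (\<rho> a u)"
      "\<sigma> (dbracket a b) w = \<sigma> a (\<sigma> b w) - \<sigma> b (\<sigma> a w)" for a b c u w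
    using assms unfolding diffop_module_def cbilinear_def clinear_iff by simp_all
  have diff: "(u - u') \<otimes>\<^sub>C w = u \<otimes>\<^sub>C w - u' \<otimes>\<^sub>C w" "u \<otimes>\<^sub>C (w - w') = u \<otimes>\<^sub>C w - u \<otimes>\<^sub>C w'"
    for u u' :: 'a and w w' :: 'b
    using pure_tensor_add_left[of "u - u'" u' w] pure_tensor_add_right[of u "w - w'" w']
    by (simp_all add: eq_diff_eq)
  have "?T (a + b) t = ?T a t + ?T b t" for a b t
    by (rule clinear_tensor_eqI)
      (use T_lin in \<open>simp_all add: T mod clinear_iff scaleC_add_right pure_tensor_add_left
        pure_tensor_add_right add_ac\<close>)
  moreover have "?T (c *\<^sub>C a) t = c *\<^sub>C ?T a t" for a c t
    by (rule clinear_tensor_eqI)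
      (use T_lin in \<open>simp_all add: T mod clinear_iff scaleC_add_right pure_tensor_scale_left
        pure_tensor_scale_right mult.commute\<close>)
  moreover have "?T (dbracket a b) t = ?T a (?T b t) - ?T b (?T a t)" for a b t
    by (rule clinear_tensor_eqI)
      (use T_lin in \<open>simp_all add: T mod clinear_iff diff complex_vector.scale_right_diff_distrib\<close>)
  ultimately show ?thesis
    using lin unfolding diffop_module_def cbilinear_def by (simp add: clinear_iff)
qed

end

theory Submission
  imports Defs
begin

text \<open>
  Let \<open>V\<close> be the highest weight module and \<open>W\<close> a nonzero submodule of \<open>\<Omega>(\<lambda>, \<epsilon>) \<otimes> V\<close>.
  Operators of large positive degree see only the left factor: the vectors of \<open>V\<close> that are
  killed by all \<open>t\<^sup>m D\<^sup>n\<close> with \<open>m\<close> large form a submodule which contains the highest weight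
  vector, hence they are all of \<open>V\<close> (\<open>highest_weight_module_eventually_killed\<close>).  So for a fixed
  element \<open>\<Sum> f\<^sub>i \<otimes> w\<^sub>i\<close> of \<open>W\<close>, a fixed \<open>n\<close> and every large \<open>m\<close>, the element
  \<open>\<Sum> (x - \<epsilon>m)\<^sup>n f\<^sub>i(x - m) \<otimes> w\<^sub>i\<close> lies in \<open>W\<close> as well (\<open>tensor_action_left\<close>).

  This element depends polynomially on \<open>m\<close>, and a polynomial whose values at all large integers
  lie in a subspace has its coefficients there (\<open>coefficients_in_subspace\<close>).  Two coefficients
  suffice.
  \<^item> Write a nonzero element of \<open>W\<close> as \<open>\<Sum>\<^bsub>i\<le>d\<^esub> x\<^sup>i \<otimes> w\<^sub>i\<close> with \<open>w\<^sub>d \<noteq> 0\<close>.  For \<open>n = 0\<close> the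
    coefficient of \<open>m\<^sup>d\<close> is \<open>\<plusminus> 1 \<otimes> w\<^sub>d\<close>, because \<open>(x - m)\<^sup>i\<close> has degree \<open>i\<close> in \<open>m\<close>.
    So \<open>W\<close> contains \<open>1 \<otimes> w\<close> for some \<open>w \<noteq> 0\<close>.
  \<^item> Applied to \<open>1 \<otimes> w\<close>, the operators \<open>t\<^sup>m D\<^sup>n\<close> with \<open>m\<close> large give, up to a nonzero scalar,
    \<open>(x - \<epsilon>m)\<^sup>n \<otimes> w\<close>, whose constant coefficient in \<open>m\<close> is \<open>x\<^sup>n \<otimes> w\<close>.  So \<open>W\<close> contains \<open>\<Omega>(\<lambda>, \<epsilon>) \<otimes> w\<close>.

  Finally, the vectors \<open>w\<close> with \<open>\<Omega>(\<lambda>, \<epsilon>) \<otimes> w \<subseteq> W\<close> form a submodule of \<open>V\<close>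
  (\<open>submodule_tensor_slice\<close>).  It is nonzero, so it is \<open>V\<close>, and \<open>W\<close> is everything.
\<close>

section \<open>Polynomial families in a subspace\<close>

lemma clinear_0: "clinear f \<Longrightarrow> f 0 = 0"
  unfolding clinear_iff by (metis complex_vector.scale_zero_left)

text \<open>
  If \<open>P(m) = \<Sum>\<^bsub>k\<le>d\<^esub> m\<^sup>k c\<^sub>k\<close> then \<open>P(2m) - 2\<^sup>d P(m)\<close> has degree less than \<open>d\<close>, and its
  coefficients \<open>(2\<^sup>k - 2\<^sup>d) c\<^sub>k\<close> are nonzero multiples of the old ones.  So induction on the
  degree yields every \<open>c\<^sub>k\<close> with \<open>k < d\<close>, and \<open>c\<^sub>d\<close> is what remains of a single value.
  Doubling keeps the argument above the threshold.
\<close>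

lemma coefficients_in_subspace:
  fixes c :: "nat \<Rightarrow> 'a::complex_vector"
  assumes W: "csubspace W"
    and mem: "\<And>m. m \<ge> K \<Longrightarrow> (\<Sum>k\<le>d. of_nat m ^ k *\<^sub>C c k) \<in> W"
    and k: "k \<le> d"
  shows "c k \<in> W"
  using mem k
proof (induction d arbitrary: c k)
  case 0
  from "0.prems"(1)[of K] "0.prems"(2) show ?case by (simp add: scaleC_one)
next
  case (Suc d)
  have low: "c j \<in> W" if j: "j \<le> d" for j
  proof -
    have "(2 ^ j - 2 ^ Suc d) *\<^sub>C c j \<in> W"
    proof (rule Suc.IH[OF _ j, of "\<lambda>j. (2 ^ j - 2 ^ Suc d) *\<^sub>C c j"])
      fix m assume m: "m \<ge> K"
      have "(\<Sum>k\<le>Suc d. of_nat (2 * m) ^ k *\<^sub>C c k)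
          - 2 ^ Suc d *\<^sub>C (\<Sum>k\<le>Suc d. of_nat m ^ k *\<^sub>C c k) \<in> W"
        using m by (intro complex_vector.subspace_diff[OF W] complex_vector.subspace_scale[OF W]
            Suc.prems(1)) simp_all
      also have "(\<Sum>k\<le>Suc d. of_nat (2 * m) ^ k *\<^sub>C c k)
          - 2 ^ Suc d *\<^sub>C (\<Sum>k\<le>Suc d. of_nat m ^ k *\<^sub>C c k)
        = (\<Sum>k\<le>Suc d. of_nat m ^ k *\<^sub>C (2 ^ k - 2 ^ Suc d) *\<^sub>C c k)"
        unfolding complex_vector.scale_sum_right sum_subtractf[symmetric]
        by (intro sum.cong refl)
          (simp add: scaleC_scaleC power_mult_distrib algebra_simps
            flip: complex_vector.scale_left_diff_distrib)
      finally show "(\<Sum>k\<le>d. of_nat m ^ k *\<^sub>C (2 ^ k - 2 ^ Suc d) *\<^sub>C c k) \<in> W"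
        by simp
    qed
    then have "inverse (2 ^ j - 2 ^ Suc d) *\<^sub>C (2 ^ j - 2 ^ Suc d) *\<^sub>C c j \<in> W"
      by (rule complex_vector.subspace_scale[OF W])
    moreover have "(2::complex) ^ j \<noteq> 2 ^ Suc d"
    proof
      assume "(2::complex) ^ j = 2 ^ Suc d"
      then have "of_nat (2 ^ j) = (of_nat (2 ^ Suc d) :: complex)" by simp
      then have "(2::nat) ^ j = 2 ^ Suc d" by (simp only: of_nat_eq_iff)
      then show False
        using j power_inject_exp[of "2 :: nat" j "Suc d"] by (simp del: power_Suc)
    qed
    ultimately show ?thesis by (simp add: scaleC_scaleC scaleC_one)
  qed
  show ?case
  proof (cases "k = Suc d")
    case False
    with Suc.prems(2) low show ?thesis by simp
  next
    case True
    \<comment> \<open>The value at \<open>0\<close> would not determine the top coefficient, hence the bound \<open>1\<close>.\<close>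
    let ?m = "max K 1"
    have "(\<Sum>k\<le>Suc d. of_nat ?m ^ k *\<^sub>C c k) - (\<Sum>k\<le>d. of_nat ?m ^ k *\<^sub>C c k) \<in> W"
      by (intro complex_vector.subspace_diff[OF W] complex_vector.subspace_sum[OF W]
          complex_vector.subspace_scale[OF W] Suc.prems(1)) (auto intro: low)
    then have "of_nat ?m ^ Suc d *\<^sub>C c (Suc d) \<in> W" by simp
    then have "inverse (of_nat ?m ^ Suc d) *\<^sub>C of_nat ?m ^ Suc d *\<^sub>C c (Suc d) \<in> W"
      by (rule complex_vector.subspace_scale[OF W])
    moreover have "(of_nat ?m :: complex) \<noteq> 0" by simp
    ultimately show ?thesis
      using True by (simp add: scaleC_scaleC scaleC_one del: power_Suc)
  qed
qed

section \<open>Operators of large degree annihilate each vector\<close>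

text \<open>The bound on the degree \<open>m\<close> may depend on \<open>w\<close> but must be uniform in the order \<open>n\<close>.\<close>

definition eventually_killed :: "(diffop \<Rightarrow> 'v \<Rightarrow> 'v::complex_vector) \<Rightarrow> 'v \<Rightarrow> bool" where
  "eventually_killed act w \<longleftrightarrow> (\<exists>K. \<forall>m\<ge>K. \<forall>n. act (tD m n) w = 0)"

text \<open>The bracket is graded: \<open>[t\<^sup>m D\<^sup>n, t\<^sup>r D\<^sup>s]\<close> is a combination of the \<open>t\<^sup>m\<^sup>+\<^sup>r D\<^sup>k\<close>.\<close>

lemma act_dbracket_tD_eq_0:
  assumes "diffop_module act" and "\<And>n. act (tD (m + r) n) w = 0"
  shows "act (dbracket (tD m n) (tD r s)) w = 0"
proof -
  interpret L: Vector_Spaces.linear scaleC scaleC "\<lambda>a. act a w"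
    using assms(1) by (simp add: diffop_module_def cbilinear_def)
  have "act (basis_mult (m, n) (r, s)) w = 0" "act (basis_mult (r, s) (m, n)) w = 0"
    using assms(2) by (simp_all add: basis_mult_def L.sum L.scale add.commute)
  then show ?thesis by (simp add: dbracket_def dmult_tD L.diff)
qed

text \<open>
  Commuting \<open>t\<^sup>m D\<^sup>n\<close> past \<open>t\<^sup>r D\<^sup>s\<close> costs a bracket of degree \<open>m + r\<close>.  So if degrees
  from \<open>K\<close> on kill \<open>w\<close>, then degrees from \<open>max K (K - r)\<close> on kill \<open>t\<^sup>r D\<^sup>s w\<close>.
\<close>

lemma submodule_eventually_killed:
  assumes "diffop_module act"
  shows "submodule act {w. eventually_killed act w}"
proof -
  have lin: "clinear (act a)" "clinear (\<lambda>a. act a w)" for a w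
    using assms by (simp_all add: diffop_module_def cbilinear_def)
  have br: "act a (act b w) = act (dbracket a b) w + act b (act a w)" for a b w
    using assms by (simp add: diffop_module_def)
  have zero: "act a 0 = 0" for a
    using lin(1) by (rule clinear_0)
  have sub: "csubspace {w. eventually_killed act w}"
  proof (rule complex_vector.subspaceI)
    show "0 \<in> {w. eventually_killed act w}" by (simp add: eventually_killed_def zero)
  next
    fix x y assume "x \<in> {w. eventually_killed act w}" "y \<in> {w. eventually_killed act w}"
    then obtain K L where "\<forall>m\<ge>K. \<forall>n. act (tD m n) x = 0" "\<forall>m\<ge>L. \<forall>n. act (tD m n) y = 0"
      by (auto simp: eventually_killed_def)
    then have "\<forall>m\<ge>max K L. \<forall>n. act (tD m n) (x + y) = 0"
      using lin(1) by (simp add: clinear_iff)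
    then show "x + y \<in> {w. eventually_killed act w}" unfolding eventually_killed_def by blast
  next
    fix c x assume "x \<in> {w. eventually_killed act w}"
    then show "c *\<^sub>C x \<in> {w. eventually_killed act w}"
      using lin(1) by (fastforce simp: eventually_killed_def clinear_iff)
  qed
  have basis: "eventually_killed act (act (tD r s) w)" if w: "eventually_killed act w" for r s w
  proof -
    from w obtain K where K: "\<forall>m\<ge>K. \<forall>n. act (tD m n) w = 0"
      by (auto simp: eventually_killed_def)
    have "act (tD m n) (act (tD r s) w) = 0" if "m \<ge> max K (K - r)" for m n
      using that K by (subst br) (simp add: act_dbracket_tD_eq_0[OF assms] zero)
    then show ?thesis unfolding eventually_killed_def by blast
  qed
  have "eventually_killed act (act a w)" if w: "eventually_killed act w" for a w
  proof -
    interpret L: Vector_Spaces.linear scaleC scaleC "\<lambda>a. act a w"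
      by (rule lin)
    have "act a w = (\<Sum>k\<in>Poly_Mapping.keys a. Poly_Mapping.lookup a k *\<^sub>C act (tD (fst k) (snd k)) w)"
      by (subst poly_mapping_expansion[of a, symmetric]) (simp only: L.sum L.scale tD_def prod.collapse)
    also have "\<dots> \<in> {w. eventually_killed act w}"
      using basis[OF w] by (intro complex_vector.subspace_sum[OF sub] complex_vector.subspace_scale[OF sub]) simp
    finally show ?thesis by simp
  qed
  with sub show ?thesis by (simp add: submodule_def)
qed

lemma highest_weight_module_eventually_killed:
  assumes "highest_weight_module act"
  shows "eventually_killed act w"
proof -
  from assms obtain v where v: "highest_weight_vector act v" and irr: "irreducible_module act"
    by (auto simp: highest_weight_module_def)
  have "tD m n \<in> D_plus" if "m \<ge> 1" for m n
    unfolding D_plus_def graded_part_def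
    using that by (intro complex_vector.span_base UN_I[of m]) (auto intro: complex_vector.span_base)
  with v have "v \<noteq> 0" "eventually_killed act v"
    unfolding highest_weight_vector_def eventually_killed_def by blast+
  moreover have "submodule act {w. eventually_killed act w}"
    using irr by (intro submodule_eventually_killed) (simp add: irreducible_module_def)
  ultimately have "{w. eventually_killed act w} = UNIV"
    using irr unfolding irreducible_module_def by blast
  then show ?thesis by blast
qed

section \<open>Tensors as vector-valued polynomials\<close>

text \<open>
  This is the canonical isomorphism of \<open>V[x]\<close> with \<open>\<complex>[x] \<otimes> V\<close>.  Through it a tensor acquires a
  degree and a leading coefficient.
\<close>

definition tensor_of_poly :: "'v::complex_vector poly \<Rightarrow> (complex poly, 'v) tensor" where
  "tensor_of_poly q = (\<Sum>i\<le>degree q. monom 1 i \<otimes>\<^sub>C coeff q i)"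

lemma clinear_pure_tensor:
  shows clinear_pure_tensor_left: "clinear (\<lambda>u. u \<otimes>\<^sub>C w)"
    and clinear_pure_tensor_right: "clinear (\<lambda>w. u \<otimes>\<^sub>C w)"
  by (simp_all add: clinear_iff pure_tensor_add_left pure_tensor_add_right
      pure_tensor_scale_left pure_tensor_scale_right)

lemma tensor_of_poly_superset:
  assumes "degree q \<le> N"
  shows "tensor_of_poly q = (\<Sum>i\<le>N. monom 1 i \<otimes>\<^sub>C coeff q i)"
  unfolding tensor_of_poly_def
  using assms clinear_0[OF clinear_pure_tensor_right]
  by (intro sum.mono_neutral_left) (auto simp: coeff_eq_0 not_le)

lemma clinear_tensor_of_poly: "clinear tensor_of_poly"
  unfolding clinear_iff
proof (intro conjI allI)
  fix p q :: "'a poly"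
  let ?N = "max (degree p) (degree q)"
  show "tensor_of_poly (p + q) = tensor_of_poly p + tensor_of_poly q"
    by (subst (1 2 3) tensor_of_poly_superset[of _ ?N])
      (simp_all add: degree_add_le_max pure_tensor_add_right sum.distrib)
next
  fix c and q :: "'a poly"
  have "degree (c *\<^sub>C q) \<le> degree q"
    by (simp add: scaleC_poly_def map_poly_degree_leq)
  then show "tensor_of_poly (c *\<^sub>C q) = c *\<^sub>C tensor_of_poly q"
    by (subst (1 2) tensor_of_poly_superset[of _ "degree q"])
      (simp_all add: scaleC_poly_def coeff_map_poly pure_tensor_scale_right
        complex_vector.scale_sum_right)
qed

lemma surj_tensor_of_poly: "surj tensor_of_poly"
proof -
  interpret L: Vector_Spaces.linear scaleC scaleC tensor_of_poly by (rule clinear_tensor_of_poly)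
  have "f \<otimes>\<^sub>C w \<in> range tensor_of_poly" for f and w :: 'a
  proof -
    interpret P: Vector_Spaces.linear scaleC scaleC "\<lambda>u. u \<otimes>\<^sub>C w" by (rule clinear_pure_tensor_left)
    have "f \<otimes>\<^sub>C w = (\<Sum>i\<le>degree f. coeff f i *\<^sub>C monom 1 i) \<otimes>\<^sub>C w"
      by (simp add: scaleC_complex_poly smult_monom poly_as_sum_of_monoms)
    also have "\<dots> = (\<Sum>i\<le>degree f. monom 1 i \<otimes>\<^sub>C (coeff f i *\<^sub>C w))"
      by (simp add: P.sum P.scale pure_tensor_scale_right)
    also have "\<dots> = tensor_of_poly (map_poly (\<lambda>c. c *\<^sub>C w) f)"
      by (subst tensor_of_poly_superset[of _ "degree f"])
        (simp_all add: map_poly_degree_leq coeff_map_poly)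
    finally show ?thesis by blast
  qed
  then have "cspan (range (\<lambda>(u, w). u \<otimes>\<^sub>C w)) \<subseteq> range (tensor_of_poly :: 'a poly \<Rightarrow> _)"
    by (intro complex_vector.span_minimal L.subspace_image complex_vector.subspace_UNIV) auto
  then show ?thesis by (auto simp: span_pure_tensor)
qed

section \<open>The action of large degrees on the left factor\<close>

text \<open>
  The scalar \<open>\<beta>\<^sup>1\<^sup>-\<^sup>n \<lambda>\<^sup>m\<close> is nonzero and the same for all \<open>f\<close>, so it can be divided out
  within a subspace.  What is left is polynomial in \<open>m\<close>.
\<close>

lemma Omega_tD_eq_scale:
  assumes "lam \<noteq> 0"
  obtains c where "c \<noteq> 0" and "\<And>f. Omega lam eps (tD m n) f =
    c *\<^sub>C ([:- (of_nat eps * of_int m), 1:] ^ n * pcompose f [:- of_int m, 1:])"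
proof
  show "((- 1) ^ (1 - eps)) powi (1 - int n) * lam powi m \<noteq> 0"
    using assms by simp
  show "Omega lam eps (tD m n) f = (((- 1) ^ (1 - eps)) powi (1 - int n) * lam powi m) *\<^sub>C
      ([:- (of_nat eps * of_int m), 1:] ^ n * pcompose f [:- of_int m, 1:])" for f
    by (simp add: Omega_def tD_def Let_def scaleC_one scaleC_complex_poly)
qed

text \<open>
  The binomial expansion in powers of \<open>a\<close>.  The summation bound \<open>d\<close> may exceed \<open>i\<close>, so that
  the expansions for several \<open>i\<close> can be added termwise.
\<close>

lemma shift_power_expansion:
  fixes c :: complex
  assumes "i \<le> d"
  shows "[:- (c * a), 1:] ^ i =
    (\<Sum>k\<le>d. a ^ k *\<^sub>C (of_nat (i choose k) * (- c) ^ k) *\<^sub>C monom 1 (i - k))"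
proof -
  have "[:- (c * a), 1:] ^ i = ([:- (c * a):] + monom 1 1) ^ i"
    by (simp add: monom_altdef)
  also have "\<dots> = (\<Sum>k\<le>i. of_nat (i choose k) * [:- (c * a):] ^ k * monom 1 1 ^ (i - k))"
    by (rule binomial_ring)
  also have "\<dots> = (\<Sum>k\<le>i. a ^ k *\<^sub>C (of_nat (i choose k) * (- c) ^ k) *\<^sub>C monom 1 (i - k))"
    by (intro sum.cong refl) (simp add: of_nat_poly poly_const_pow scaleC_complex_poly
        monom_power smult_monom mult_ac flip: power_mult_distrib)
  also have "\<dots> = (\<Sum>k\<le>d. a ^ k *\<^sub>C (of_nat (i choose k) * (- c) ^ k) *\<^sub>C monom 1 (i - k))"
    using assms by (intro sum.mono_neutral_left) (auto simp: not_le)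
  finally show ?thesis .
qed

lemma tensor_action_left:
  assumes lam: "lam \<noteq> 0" and eps: "eps \<in> {0, 1}" and act: "diffop_module act"
    and W: "submodule (tensor_action (Omega lam eps) act) W"
    and mem: "(\<Sum>i\<in>I. f i \<otimes>\<^sub>C w i) \<in> W"
    and killed: "\<And>i. i \<in> I \<Longrightarrow> act (tD m n) (w i) = 0"
  shows "(\<Sum>i\<in>I. ([:- (of_nat eps * of_int m), 1:] ^ n * pcompose (f i) [:- of_int m, 1:]) \<otimes>\<^sub>C w i) \<in> W"
proof -
  note Om = diffop_module_Omega[OF lam eps]
  interpret T: Vector_Spaces.linear scaleC scaleC "tensor_action (Omega lam eps) act (tD m n)"
    by (rule clinear_tensor_action[OF Om act])
  have sub: "csubspace W" using W by (simp add: submodule_def)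
  have zero: "u \<otimes>\<^sub>C 0 = 0" for u :: "complex poly"
    by (rule clinear_0[OF clinear_pure_tensor_right])
  obtain c where c: "c \<noteq> 0" "\<And>f. Omega lam eps (tD m n) f =
      c *\<^sub>C ([:- (of_nat eps * of_int m), 1:] ^ n * pcompose f [:- of_int m, 1:])"
    using Omega_tD_eq_scale[OF lam] by metis
  let ?s = "\<Sum>i\<in>I. ([:- (of_nat eps * of_int m), 1:] ^ n * pcompose (f i) [:- of_int m, 1:]) \<otimes>\<^sub>C w i"
  have "tensor_action (Omega lam eps) act (tD m n) (\<Sum>i\<in>I. f i \<otimes>\<^sub>C w i) = c *\<^sub>C ?s"
    unfolding T.sum complex_vector.scale_sum_right
    by (intro sum.cong refl)
      (simp add: tensor_action_pure[OF Om act] killed zero c pure_tensor_scale_left)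
  then have "c *\<^sub>C ?s \<in> W" using W mem by (metis submodule_def)
  then have "inverse c *\<^sub>C c *\<^sub>C ?s \<in> W" by (rule complex_vector.subspace_scale[OF sub])
  then show ?thesis using c by (simp add: scaleC_scaleC scaleC_one)
qed

lemma pcompose_monom_shift: "pcompose (monom 1 i) [:- a, 1:] = [:- a, 1:] ^ i" for a :: complex
  by (simp add: monom_altdef pcompose_power pcompose_pCons)

section \<open>Submodules of the tensor product\<close>

text \<open>
  Up to a scalar, the operators \<open>t\<^sup>m\<close> shift the variable by \<open>m\<close>.  Among the shifted powers \<open>(x - m)\<^sup>i\<close>, \<open>i \<le> d\<close>, only
  the one with \<open>i = d\<close> contributes to \<open>m\<^sup>d\<close>, and its contribution is the constant \<open>(-1)\<^sup>d\<close>.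
  This isolates the leading coefficient of a tensor.
\<close>

lemma exists_one_tensor_in_submodule:
  assumes lam: "lam \<noteq> 0" and eps: "eps \<in> {0, 1}" and act: "diffop_module act"
    and killed: "\<And>w. eventually_killed act w"
    and W: "submodule (tensor_action (Omega lam eps) act) W"
    and nz: "W \<noteq> {0}"
  shows "\<exists>w. w \<noteq> 0 \<and> 1 \<otimes>\<^sub>C w \<in> W"
proof -
  have sub: "csubspace W" using W by (simp add: submodule_def)
  interpret L: Vector_Spaces.linear scaleC scaleC "tensor_of_poly :: 'a poly \<Rightarrow> _"
    by (rule clinear_tensor_of_poly)
  obtain t where t: "t \<in> W" "t \<noteq> 0"
    using nz complex_vector.subspace_0[OF sub] by blast
  obtain q where q: "t = tensor_of_poly q" using surj_tensor_of_poly by (metis surjD)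
  have "q \<noteq> 0" using q t L.zero by metis
  define d where "d = degree q"
  have "\<forall>i. \<exists>K. \<forall>m\<ge>K. \<forall>n. act (tD m n) (coeff q i) = 0"
    using killed by (simp add: eventually_killed_def)
  then obtain K where K: "\<And>i m n. m \<ge> K i \<Longrightarrow> act (tD m n) (coeff q i) = 0" by metis
  \<comment> \<open>from the common degree \<open>N\<close> on, all coefficients of \<open>q\<close> are killed\<close>
  define N where "N = nat (Max (K ` {..d}))"
  define c where "c k = (\<Sum>i\<le>d. ((of_nat (i choose k) * (- 1) ^ k) *\<^sub>C monom (1 :: complex) (i - k)) \<otimes>\<^sub>C coeff q i)" for k
  have "(\<Sum>k\<le>d. of_nat m ^ k *\<^sub>C c k) \<in> W" if m: "m \<ge> N" for m
  proof -
    let ?s = "\<lambda>i. [:- (of_nat eps * of_int (int m)), 1:] ^ 0 *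
        pcompose (monom 1 i) [:- of_int (int m), 1 :: complex:]"
    have "(\<Sum>i\<le>d. ?s i \<otimes>\<^sub>C coeff q i) \<in> W"
    proof (rule tensor_action_left[OF lam eps act W])
      show "(\<Sum>i\<le>d. monom 1 i \<otimes>\<^sub>C coeff q i) \<in> W"
        using t q by (simp add: tensor_of_poly_def d_def)
      fix i assume "i \<in> {..d}"
      then have "K i \<le> Max (K ` {..d})" by (intro Max_ge) auto
      then have "K i \<le> int m" using m by (simp add: N_def)
      then show "act (tD (int m) 0) (coeff q i) = 0" by (rule K)
    qed
    also have "(\<Sum>i\<le>d. ?s i \<otimes>\<^sub>C coeff q i)
      = (\<Sum>i\<le>d. \<Sum>k\<le>d. of_nat m ^ k *\<^sub>C ((of_nat (i choose k) * (- 1) ^ k) *\<^sub>C monom 1 (i - k)) \<otimes>\<^sub>C coeff q i)"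
    proof (intro sum.cong refl)
      fix i assume "i \<in> {..d}"
      interpret P: Vector_Spaces.linear scaleC scaleC "\<lambda>u::complex poly. u \<otimes>\<^sub>C coeff q i"
        by (rule clinear_pure_tensor_left)
      show "?s i \<otimes>\<^sub>C coeff q i = (\<Sum>k\<le>d. of_nat m ^ k *\<^sub>C ((of_nat (i choose k) * (- 1) ^ k) *\<^sub>C monom 1 (i - k)) \<otimes>\<^sub>C coeff q i)"
        using shift_power_expansion[of i d 1 "of_nat m"] \<open>i \<in> {..d}\<close>
        by (simp add: pcompose_monom_shift P.sum P.scale scaleC_scaleC)
    qed
    also have "\<dots> = (\<Sum>k\<le>d. of_nat m ^ k *\<^sub>C c k)"
      unfolding c_def complex_vector.scale_sum_right
      by (subst sum.swap) (simp add: pure_tensor_scale_left scaleC_scaleC)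
    finally show ?thesis .
  qed
  then have "c d \<in> W" by (rule coefficients_in_subspace[OF sub]) auto
  also have "c d = (\<Sum>i\<in>{d}. ((of_nat (i choose d) * (- 1) ^ d) *\<^sub>C monom 1 (i - d)) \<otimes>\<^sub>C coeff q i)"
    unfolding c_def
    by (intro sum.mono_neutral_right)
      (auto simp: le_less binomial_eq_0 clinear_0[OF clinear_pure_tensor_left])
  also have "\<dots> = 1 \<otimes>\<^sub>C ((- 1) ^ d *\<^sub>C lead_coeff q)"
    by (simp add: d_def pure_tensor_scale_left pure_tensor_scale_right)
  finally have "1 \<otimes>\<^sub>C ((- 1) ^ d *\<^sub>C lead_coeff q) \<in> W" .
  moreover have "(- 1) ^ d *\<^sub>C lead_coeff q \<noteq> 0" using \<open>q \<noteq> 0\<close> by simp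
  ultimately show ?thesis by blast
qed

text \<open>
  For large \<open>m\<close> the vectors \<open>(x - \<epsilon>m)\<^sup>n \<otimes> w\<close> lie in \<open>W\<close>, hence so does \<open>x\<^sup>n \<otimes> w\<close>, their
  constant coefficient as polynomials in \<open>m\<close>.
\<close>

lemma Omega_tensor_in_submodule:
  assumes lam: "lam \<noteq> 0" and eps: "eps \<in> {0, 1}" and act: "diffop_module act"
    and killed: "eventually_killed act w"
    and W: "submodule (tensor_action (Omega lam eps) act) W"
    and one: "1 \<otimes>\<^sub>C w \<in> W"
  shows "f \<otimes>\<^sub>C w \<in> W"
proof -
  have sub: "csubspace W" using W by (simp add: submodule_def)
  interpret P: Vector_Spaces.linear scaleC scaleC "\<lambda>u::complex poly. u \<otimes>\<^sub>C w"
    by (rule clinear_pure_tensor_left)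
  from killed obtain K where K: "\<forall>m\<ge>K. \<forall>n. act (tD m n) w = 0"
    by (auto simp: eventually_killed_def)
  have "monom 1 n \<otimes>\<^sub>C w \<in> W" for n
  proof -
    let ?s = "\<lambda>m. [:- (of_nat eps * of_int (int m)), 1:] ^ n *
        pcompose 1 [:- of_int (int m), 1 :: complex:]"
    let ?c = "\<lambda>k. ((of_nat (n choose k) * (- of_nat eps) ^ k) *\<^sub>C monom 1 (n - k)) \<otimes>\<^sub>C w"
    have "?c 0 \<in> W"
    proof (rule coefficients_in_subspace[OF sub, where K = "nat K" and d = n and c = ?c])
      fix m assume "m \<ge> nat K"
      then have "act (tD (int m) n) w = 0" using K by simp
      \<comment> \<open>a pure tensor is a sum over a singleton\<close>
      then have "(\<Sum>i\<in>{0::nat}. ?s m \<otimes>\<^sub>C w) \<in> W"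
        using one by (intro tensor_action_left[OF lam eps act W]) auto
      also have "(\<Sum>i\<in>{0::nat}. ?s m \<otimes>\<^sub>C w) = (\<Sum>k\<le>n. of_nat m ^ k *\<^sub>C ?c k)"
        using shift_power_expansion[of n n "of_nat eps" "of_nat m"]
        by (simp add: pcompose_1 P.sum P.scale scaleC_scaleC)
      finally show "(\<Sum>k\<le>n. of_nat m ^ k *\<^sub>C ?c k) \<in> W" .
    qed simp
    then show ?thesis by (simp add: scaleC_one)
  qed
  then have "(\<Sum>i\<le>degree f. coeff f i *\<^sub>C (monom (1 :: complex) i \<otimes>\<^sub>C w)) \<in> W"
    by (intro complex_vector.subspace_sum[OF sub] complex_vector.subspace_scale[OF sub])
  also have "(\<Sum>i\<le>degree f. coeff f i *\<^sub>C (monom (1 :: complex) i \<otimes>\<^sub>C w)) = (\<Sum>i\<le>degree f. coeff f i *\<^sub>C monom 1 i) \<otimes>\<^sub>C w"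
    by (simp add: P.sum P.scale)
  also have "\<dots> = f \<otimes>\<^sub>C w"
    by (simp add: scaleC_complex_poly smult_monom poly_as_sum_of_monoms)
  finally show ?thesis .
qed

text \<open>
  By the Leibniz rule \<open>u \<otimes> a w = a (u \<otimes> w) - a u \<otimes> w\<close>, and both terms lie in \<open>W\<close> when all of
  \<open>U \<otimes> w\<close> does, where \<open>U\<close> is the left factor.
\<close>

lemma submodule_tensor_slice:
  assumes "diffop_module \<rho>" and "diffop_module act"
    and W: "submodule (tensor_action \<rho> act) W"
  shows "submodule act {w. \<forall>u. u \<otimes>\<^sub>C w \<in> W}"
proof -
  have sub: "csubspace W" using W by (simp add: submodule_def)
  have "u \<otimes>\<^sub>C act a w \<in> W" if "\<forall>u. u \<otimes>\<^sub>C w \<in> W" for a u w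
  proof -
    have "tensor_action \<rho> act a (u \<otimes>\<^sub>C w) - \<rho> a u \<otimes>\<^sub>C w \<in> W"
      using that W by (intro complex_vector.subspace_diff[OF sub]) (auto simp: submodule_def)
    then show ?thesis by (simp add: tensor_action_pure assms)
  qed
  moreover have "csubspace {w. \<forall>u. u \<otimes>\<^sub>C w \<in> W}"
    using sub
    by (auto intro!: complex_vector.subspaceI simp: pure_tensor_add_right pure_tensor_scale_right
        clinear_0[OF clinear_pure_tensor_right] complex_vector.subspace_0 complex_vector.subspace_add complex_vector.subspace_scale)
  ultimately show ?thesis by (simp add: submodule_def)
qed

text \<open>Evaluation of the polynomial at \<open>0\<close> induces a map \<open>\<complex>[x] \<otimes> V \<rightarrow> V\<close> that sends \<open>1 \<otimes> w\<close> to \<open>w\<close>.\<close>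

lemma one_tensor_eq_0_iff: "(1 :: complex poly) \<otimes>\<^sub>C w = 0 \<longleftrightarrow> w = 0"
proof
  let ?B = "\<lambda>(f :: complex poly) w. coeff f 0 *\<^sub>C w"
  have B: "cbilinear ?B"
    by (simp add: cbilinear_def clinear_iff scaleC_add_left scaleC_add_right scaleC_scaleC
        scaleC_complex_poly mult.commute)
  assume "(1 :: complex poly) \<otimes>\<^sub>C w = 0"
  then have "?B 1 w = 0"
    using tensor_lift_pure[OF B, of 1 w] clinear_0[OF clinear_tensor_lift[OF B]] by metis
  then show "w = 0" by (simp add: scaleC_one)
qed (simp add: clinear_0[OF clinear_pure_tensor_right])

theorem theorem4p1:
  fixes lam :: complex and eps :: nat
    and act :: "diffop \<Rightarrow> 'v::complex_vector \<Rightarrow> 'v"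
  assumes "lam \<noteq> 0" and "eps \<in> {0, 1}"
    and "highest_weight_module act"
    and "quasi_finite act"
  shows "irreducible_module (tensor_action (Omega lam eps) act)"
proof -
  have irr: "irreducible_module act" and act: "diffop_module act"
    using assms(3) by (simp_all add: highest_weight_module_def irreducible_module_def)
  note Om = diffop_module_Omega[OF assms(1,2)]
  note killed = highest_weight_module_eventually_killed[OF assms(3)]
  obtain v :: 'v where "v \<noteq> 0" using irr by (auto simp: irreducible_module_def)
  then have "(UNIV :: (complex poly, 'v) tensor set) \<noteq> {0}"
    using one_tensor_eq_0_iff by blast
  moreover have "W = UNIV"
    if W: "submodule (tensor_action (Omega lam eps) act) W" and nz: "W \<noteq> {0}" for W
  proof -
    obtain w where w: "w \<noteq> 0" "1 \<otimes>\<^sub>C w \<in> W"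
      using exists_one_tensor_in_submodule[OF assms(1,2) act killed W nz] by blast
    then have "\<forall>u. u \<otimes>\<^sub>C w \<in> W"
      using Omega_tensor_in_submodule[OF assms(1,2) act killed W] by blast
    then have "{w. \<forall>u. u \<otimes>\<^sub>C w \<in> W} = UNIV"
      using w irr submodule_tensor_slice[OF Om act W] unfolding irreducible_module_def by blast
    then have "cspan (range (\<lambda>(u, w). u \<otimes>\<^sub>C w)) \<subseteq> W"
      using W by (intro complex_vector.span_minimal) (auto simp: submodule_def)
    then show ?thesis by (auto simp: span_pure_tensor)
  qed
  ultimately show ?thesis
    using diffop_module_tensor_action[OF Om act] by (auto simp: irreducible_module_def)
qed

end
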